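(* Let $(P,\le)$ be a finite poset with a chain-partition $\mathcal{C}=\{C_1,\dots,C_n\}$, where $C_i=(s_{i1}<s_{i2}<\cdots<s_{im_i})$. Let $U$ be the matrix of the Moebius function of $P$ with rows and columns indexed by $s_{11}\cdots s_{1m_1}s_{21}\cdots s_{2m_2}\cdots s_{n1}\cdots s_{nm_n}$. Suppose we are given a $\mathcal{C}$-cut with $C_i^{low}=\{s_{i1},\dots,s_{im_i'}\}$ and $C_i^{up}=\{s_{i(m_i'+1)},\dots,s_{im_i}\}$, where $m_i'\ge1$ and $m_i'':=m_i-m_i'\ge 1$ for all $i$. Let $P^{low}=\bigcup_i C_i^{low}$ and $P^{up}=\bigcup_i C_i^{up}$ with the induced orders, let $U^{low}$ be the matrix of the Moebius function of $P^{low}$ with rows and columns indexed by $s_{11}\cdots s_{1m_1'}\cdots s_{n1}\cdots s_{nm_n'}$, and $U^{up}$ the matrix of the Moebius function of $P^{up}$ indexed by $s_{1(m_1'+1)}\cdots s_{1m_1}\cdots s_{n(m_n'+1)}\cdots s_{nm_n}$. Let $s=(m_1,\dots,m_n)$, $s^{low}=(m_1',\dots,m_n')$, $s^{up}=(m_1'',\dots,m_n'')$, and $J=I+J_0$, where $J_0$ is the $n\times n$ matrix with $[J_0]_{ij}=1$ if $i\neq j$ and some element of $C_i$ is comparable with some element of $C_j$, and $[J_0]_{ij}=0$ otherwise. Then $${}^c(U,s)J={}^c(U^{low},s^{low})J+{}^c(U^{up},s^{up})J-{}^c(U^{low},s^{low})J\,{}^c(U^{up},s^{up})J.$$ In particular,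 if $J$ is invertible, $${}^c(U,s)={}^c(U^{low},s^{low})+{}^c(U^{up},s^{up})-{}^c(U^{low},s^{low})J\,{}^c(U^{up},s^{up}).$$
   Context: A chain-partition of a poset $P$ is a collection of mutually disjoint chains $C_1,\dots,C_n$ with $\bigcup_iC_i=P$ such that if some $x\in C_i$ and $y\in C_j$ are comparable then all elements of $C_i$ and $C_j$ are pairwise comparable. A $\mathcal{C}$-cut cuts each chain $C_i=(\xi_1<\cdots<\xi_s)$ into $C_i^{low}=(\xi_1<\cdots<\xi_{h(i)})$ and $C_i^{up}=(\xi_{h(i)+1}<\cdots<\xi_s)$ such that any element of some $C_i^{low}$ is smaller than any element of some $C_j^{up}$ whenever they are comparable. The matrix of the Moebius function $\mu$ of a poset with elements listed as $x_1,\dots,x_N$ has $(p,q)$ entry $\mu(x_p,x_q)$ if $x_p\le x_q$ and $0$ otherwise; $\mu$ is the inverse in the incidence algebra of the zeta function $\zeta(x,y)=1$ for $x\le y$. Block-compression: for an $m\times m$ matrix $T$ and $s=(m_1,\dots,m_n)$ with $m_k\ge 1$ and $\sum m_k=m$, ${}^c(T,s)$ is the $n\times n$ matrix whose $(r,l)$ entry is the sum of all entries of $T$ in rows $\sum_{k<r}m_k+1,\dots,\sum_{k\le r}m_k$ and columns $\sum_{k<l}m_k+1,\dots,\sum_{k\le l}m_k$. *)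

theory Defs
  imports "Jordan_Normal_Form.Matrix" "HOL.Order_Relation"
begin

text \<open>A finite poset is a finite carrier \<open>P\<close> with a relation \<open>r\<close> such that \<^term>\<open>partial_order_on P r\<close>;
  \<open>(x, y) \<in> r\<close> reads \<open>x \<le> y\<close>. The order induced on a subset \<open>Q\<close> is \<^term>\<open>Restr r Q\<close>.\<close>

definition comparable :: "'b rel \<Rightarrow> 'b \<Rightarrow> 'b \<Rightarrow> bool" where
  "comparable r x y \<longleftrightarrow> (x, y) \<in> r \<or> (y, x) \<in> r"

definition strictly_below :: "'b rel \<Rightarrow> 'b \<Rightarrow> 'b \<Rightarrow> bool" where
  "strictly_below r x y \<longleftrightarrow> (x, y) \<in> r \<and> x \<noteq> y"

subsection \<open>Incidence algebra and Moebius function\<close>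

definition incidence_algebra :: "'b rel \<Rightarrow> ('b \<Rightarrow> 'b \<Rightarrow> 'a::comm_ring_1) set" where
  "incidence_algebra r = {f. \<forall>x y. (x, y) \<notin> r \<longrightarrow> f x y = 0}"

definition convolution ::
  "'b rel \<Rightarrow> ('b \<Rightarrow> 'b \<Rightarrow> 'a::comm_ring_1) \<Rightarrow> ('b \<Rightarrow> 'b \<Rightarrow> 'a) \<Rightarrow> 'b \<Rightarrow> 'b \<Rightarrow> 'a" where
  "convolution r f g = (\<lambda>x y. \<Sum>z | (x, z) \<in> r \<and> (z, y) \<in> r. f x z * g z y)"

definition incidence_unit :: "'b set \<Rightarrow> 'b \<Rightarrow> 'b \<Rightarrow> 'a::comm_ring_1" where
  "incidence_unit P = (\<lambda>x y. if x \<in> P \<and> x = y then 1 else 0)"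

definition zeta :: "'b rel \<Rightarrow> 'b \<Rightarrow> 'b \<Rightarrow> 'a::comm_ring_1" where
  "zeta r = (\<lambda>x y. if (x, y) \<in> r then 1 else 0)"

definition is_moebius :: "'b set \<Rightarrow> 'b rel \<Rightarrow> ('b \<Rightarrow> 'b \<Rightarrow> 'a::comm_ring_1) \<Rightarrow> bool" where
  "is_moebius P r \<mu> \<longleftrightarrow> \<mu> \<in> incidence_algebra r \<and>
     convolution r \<mu> (zeta r) = incidence_unit P \<and>
     convolution r (zeta r) \<mu> = incidence_unit P"

text \<open>Well defined for finite posets by \<open>ex1_moebius\<close> below.\<close>

definition moebius :: "'b set \<Rightarrow> 'b rel \<Rightarrow> 'b \<Rightarrow> 'b \<Rightarrow> 'a::comm_ring_1" where
  "moebius P r = (THE \<mu>. is_moebius P r \<mu>)"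

definition moebius_mat :: "'b set \<Rightarrow> 'b rel \<Rightarrow> 'b list \<Rightarrow> 'a::comm_ring_1 mat" where
  "moebius_mat P r xs = mat (length xs) (length xs)
     (\<lambda>(p, q). if (xs ! p, xs ! q) \<in> r then moebius P r (xs ! p) (xs ! q) else 0)"

subsection \<open>Chain-partitions and cuts\<close>

text \<open>A chain \<open>C\<^sub>i = (s\<^sub>i\<^sub>1 < \<dots> < s\<^sub>i\<^sub>m)\<close> is given by the list of its elements in ascending order,
  and a chain-partition by the list of its chains. Indices start at 0.\<close>

definition ascending_chain :: "'b rel \<Rightarrow> 'b list \<Rightarrow> bool" where
  "ascending_chain r xs \<longleftrightarrow> sorted_wrt (strictly_below r) xs"

definition chain_partition :: "'b set \<Rightarrow> 'b rel \<Rightarrow> 'b list list \<Rightarrow> bool" where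
  "chain_partition P r Cs \<longleftrightarrow>
     (\<forall>C\<in>set Cs. ascending_chain r C) \<and>
     (\<forall>i<length Cs. \<forall>j<length Cs. i \<noteq> j \<longrightarrow> set (Cs ! i) \<inter> set (Cs ! j) = {}) \<and>
     (\<Union>C\<in>set Cs. set C) = P \<and>
     (\<forall>i<length Cs. \<forall>j<length Cs.
        (\<exists>x\<in>set (Cs ! i). \<exists>y\<in>set (Cs ! j). comparable r x y) \<longrightarrow>
        (\<forall>x\<in>set (Cs ! i) \<union> set (Cs ! j). \<forall>y\<in>set (Cs ! i) \<union> set (Cs ! j). comparable r x y))"

text \<open>A cut is given by the number \<open>h i\<close> of elements in the lower part of each chain.\<close>

definition low_chains :: "'b list list \<Rightarrow> (nat \<Rightarrow> nat) \<Rightarrow> 'b list list" where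
  "low_chains Cs h = map (\<lambda>i. take (h i) (Cs ! i)) [0..<length Cs]"

definition up_chains :: "'b list list \<Rightarrow> (nat \<Rightarrow> nat) \<Rightarrow> 'b list list" where
  "up_chains Cs h = map (\<lambda>i. drop (h i) (Cs ! i)) [0..<length Cs]"

definition chain_cut :: "'b rel \<Rightarrow> 'b list list \<Rightarrow> (nat \<Rightarrow> nat) \<Rightarrow> bool" where
  "chain_cut r Cs h \<longleftrightarrow>
     (\<forall>i<length Cs. h i \<le> length (Cs ! i)) \<and>
     (\<forall>i<length Cs. \<forall>j<length Cs.
        \<forall>x\<in>set (low_chains Cs h ! i). \<forall>y\<in>set (up_chains Cs h ! j).
          comparable r x y \<longrightarrow> strictly_below r x y)"

definition comparability_mat :: "'b rel \<Rightarrow> 'b list list \<Rightarrow> 'a::comm_ring_1 mat" where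
  "comparability_mat r Cs = mat (length Cs) (length Cs)
     (\<lambda>(i, j). if i \<noteq> j \<and> (\<exists>x\<in>set (Cs ! i). \<exists>y\<in>set (Cs ! j). comparable r x y) then 1 else 0)"

subsection \<open>Block-compression\<close>

definition block :: "nat list \<Rightarrow> nat \<Rightarrow> nat set" where
  "block s k = {sum_list (take k s)..<sum_list (take (Suc k) s)}"

definition block_compress :: "'a::comm_ring_1 mat \<Rightarrow> nat list \<Rightarrow> 'a mat" where
  "block_compress T s = mat (length s) (length s)
     (\<lambda>(k, l). \<Sum>p\<in>block s k. \<Sum>q\<in>block s l. T $$ (p, q))"

subsection \<open>Existence and uniqueness of the Moebius function\<close>

lemma convolution_assoc:
  fixes f g h :: "'b \<Rightarrow> 'b \<Rightarrow> 'a::comm_ring_1"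
  assumes "finite r" "trans r"
  shows "convolution r (convolution r f g) h = convolution r f (convolution r g h)"
proof (intro ext)
  fix x y
  let ?A = "{z. (x, z) \<in> r \<and> (z, y) \<in> r}"
  have fin: "finite {z. (a, z) \<in> r \<and> (z, b) \<in> r}" for a b
    by (rule finite_subset[of _ "snd ` r"]) (use assms in \<open>force+\<close>)
  have "convolution r (convolution r f g) h x y
      = (\<Sum>z\<in>?A. \<Sum>w | (x, w) \<in> r \<and> (w, z) \<in> r. f x w * g w z * h z y)"
    by (simp add: convolution_def sum_distrib_right)
  also have "\<dots> = (\<Sum>z\<in>?A. \<Sum>w | w \<in> ?A \<and> (w, z) \<in> r. f x w * g w z * h z y)"
    using \<open>trans r\<close> by (intro sum.cong refl) (auto dest: transD)
  also have "\<dots> = (\<Sum>w\<in>?A. \<Sum>z | z \<in> ?A \<and> (w, z) \<in> r. f x w * g w z * h z y)"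
    by (rule sum.swap_restrict) (rule fin)+
  also have "\<dots> = (\<Sum>w\<in>?A. \<Sum>z | (w, z) \<in> r \<and> (z, y) \<in> r. f x w * g w z * h z y)"
    using \<open>trans r\<close> by (intro sum.cong refl) (auto dest: transD)
  also have "\<dots> = convolution r f (convolution r g h) x y"
    by (simp add: convolution_def sum_distrib_left mult.assoc)
  finally show "convolution r (convolution r f g) h x y = convolution r f (convolution r g h) x y" .
qed

lemma convolution_unit_left:
  fixes f :: "'b \<Rightarrow> 'b \<Rightarrow> 'a::comm_ring_1"
  assumes "finite r" "partial_order_on P r" "f \<in> incidence_algebra r"
  shows "convolution r (incidence_unit P) f = f"
proof (intro ext)
  fix x y
  have fin: "finite {z. (x, z) \<in> r \<and> (z, y) \<in> r}"
    by (rule finite_subset[of _ "snd ` r"]) (use assms in \<open>force+\<close>)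
  have r: "x \<in> P \<and> (x, x) \<in> r" if "(x, y) \<in> r"
    using assms that by (auto simp: partial_order_on_def preorder_on_def refl_on_def)
  have "convolution r (incidence_unit P) f x y
      = (\<Sum>z | (x, z) \<in> r \<and> (z, y) \<in> r. if z = x then f x y else 0)"
    unfolding convolution_def incidence_unit_def using assms(2)
    by (intro sum.cong refl) (auto simp: partial_order_on_def preorder_on_def refl_on_def)
  also have "\<dots> = f x y"
    using r assms(3) fin by (auto simp: sum.delta incidence_algebra_def)
  finally show "convolution r (incidence_unit P) f x y = f x y" .
qed

lemma convolution_converse:
  fixes f g :: "'b \<Rightarrow> 'b \<Rightarrow> 'a::comm_ring_1"
  shows "convolution (r\<inverse>) f g = (\<lambda>x y. convolution r (\<lambda>x y. g y x) (\<lambda>x y. f y x) y x)"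
  by (auto simp: convolution_def fun_eq_iff mult.commute intro!: sum.cong)

lemma convolution_unit_right:
  fixes f :: "'b \<Rightarrow> 'b \<Rightarrow> 'a::comm_ring_1"
  assumes "finite r" "partial_order_on P r" "f \<in> incidence_algebra r"
  shows "convolution r f (incidence_unit P) = f"
proof -
  have "(\<lambda>x y. incidence_unit P y x) = (incidence_unit P :: 'b \<Rightarrow> 'b \<Rightarrow> 'a)"
    by (auto simp: incidence_unit_def fun_eq_iff)
  moreover have "convolution (r\<inverse>) (incidence_unit P) (\<lambda>x y. f y x) = (\<lambda>x y. f y x)"
    by (rule convolution_unit_left) (use assms in \<open>auto simp: incidence_algebra_def\<close>)
  ultimately show ?thesis
    by (auto simp: convolution_converse fun_eq_iff)
qed

lemma left_inverse_zeta:
  assumes "finite r" "partial_order_on P r"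
  shows "\<exists>\<mu>\<in>incidence_algebra r.
    convolution r \<mu> (zeta r) = (incidence_unit P :: 'b \<Rightarrow> 'b \<Rightarrow> 'a::comm_ring_1)"
proof
  let ?F = "\<lambda>x f y. if (x, y) \<in> r
    then incidence_unit P x y - (\<Sum>z | (x, z) \<in> r \<and> (z, y) \<in> r - Id. f z) else (0::'a)"
  define \<mu> where "\<mu> x = wfrec (r - Id) (?F x)" for x
  have wf: "wf (r - Id)"
    using assms by (rule partial_order_on_well_order_on)
  have \<mu>: "\<mu> x y = ?F x (\<mu> x) y" for x y
  proof -
    have "\<mu> x y = ?F x (cut (\<mu> x) (r - Id) y) y"
      unfolding \<mu>_def by (rule wfrec[OF wf])
    also have "\<dots> = ?F x (\<mu> x) y"
      by (auto simp: cut_apply)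
    finally show ?thesis .
  qed
  show "\<mu> \<in> incidence_algebra r"
    by (auto simp: incidence_algebra_def \<mu>)
  have tr: "trans r" and rP: "r \<subseteq> P \<times> P" and rf: "\<And>x. x \<in> P \<Longrightarrow> (x, x) \<in> r"
    using assms(2) by (auto simp: partial_order_on_def preorder_on_def refl_on_def)
  show "convolution r \<mu> (zeta r) = incidence_unit P"
  proof (intro ext)
    fix x y
    show "convolution r \<mu> (zeta r) x y = incidence_unit P x y"
    proof (cases "(x, y) \<in> r")
      case True
      have fin: "finite {z. (x, z) \<in> r \<and> (z, y) \<in> r - Id}"
        by (rule finite_subset[of _ "snd ` r"]) (use assms in \<open>force+\<close>)
      have "{z. (x, z) \<in> r \<and> (z, y) \<in> r} = insert y {z. (x, z) \<in> r \<and> (z, y) \<in> r - Id}"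
        using True rP rf by auto
      then have "convolution r \<mu> (zeta r) x y
          = \<mu> x y + (\<Sum>z | (x, z) \<in> r \<and> (z, y) \<in> r - Id. \<mu> x z)"
        using fin True rP rf by (auto simp: convolution_def zeta_def intro!: sum.cong)
      also have "\<dots> = incidence_unit P x y"
        using True by (subst \<mu>) simp
      finally show ?thesis .
    next
      case False
      then have "{z. (x, z) \<in> r \<and> (z, y) \<in> r} = {}"
        using tr by (auto dest: transD)
      then have "convolution r \<mu> (zeta r) x y = 0"
        unfolding convolution_def by (simp only: sum.empty)
      then show ?thesis
        using False rf by (auto simp: incidence_unit_def)
    qed
  qed
qed

lemma ex1_moebius:
  assumes "finite P" "partial_order_on P r"
  shows "\<exists>!\<mu>. is_moebius P r (\<mu> :: 'b \<Rightarrow> 'b \<Rightarrow> 'a::comm_ring_1)"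
proof -
  have fin: "finite r"
    using finite_subset[OF partial_order_onD(4)[OF assms(2)]] assms(1) by simp
  have tr: "trans r"
    using assms(2) by (rule partial_order_onD)
  note unit = convolution_unit_left[OF fin assms(2)] convolution_unit_right[OF fin assms(2)]
  obtain \<mu> :: "'b \<Rightarrow> 'b \<Rightarrow> 'a" where \<mu>: "\<mu> \<in> incidence_algebra r"
    "convolution r \<mu> (zeta r) = incidence_unit P"
    using left_inverse_zeta[OF fin assms(2)] by blast
  obtain \<nu>' :: "'b \<Rightarrow> 'b \<Rightarrow> 'a" where \<nu>': "\<nu>' \<in> incidence_algebra (r\<inverse>)"
    "convolution (r\<inverse>) \<nu>' (zeta (r\<inverse>)) = incidence_unit P"
    using left_inverse_zeta[of "r\<inverse>" P] fin assms(2) by auto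
  define \<nu> where "\<nu> = (\<lambda>x y. \<nu>' y x)"
  have "(\<lambda>x y. zeta (r\<inverse>) y x) = (zeta r :: 'b \<Rightarrow> 'b \<Rightarrow> 'a)"
    by (auto simp: zeta_def fun_eq_iff)
  with \<nu>' have \<nu>: "\<nu> \<in> incidence_algebra r" "convolution r (zeta r) \<nu> = incidence_unit P"
    by (auto simp: \<nu>_def incidence_algebra_def convolution_converse incidence_unit_def fun_eq_iff)
  have eq: "f = g" if "f \<in> incidence_algebra r" "convolution r f (zeta r) = incidence_unit P"
    "g \<in> incidence_algebra r" "convolution r (zeta r) g = incidence_unit P" for f g :: "'b \<Rightarrow> 'b \<Rightarrow> 'a"
    using convolution_assoc[OF fin tr, of f "zeta r" g] that by (simp add: unit)
  from eq[OF \<mu> \<nu>] have "is_moebius P r \<mu>"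
    using \<mu> \<nu> by (simp add: is_moebius_def)
  then show ?thesis
    by (auto simp: is_moebius_def intro!: eq)
qed

end

theory Submission
  imports Defs
begin

text \<open>Write \<open>L\<close> and \<open>V\<close> for the lower and upper parts of the cut; \<open>L\<close> is a down-set. Listing \<open>L\<close> before
  \<open>V\<close>, the zeta matrix of \<open>P\<close> is block triangular with diagonal blocks \<open>A = \<zeta>\<^sub>L\<close>, \<open>D = \<zeta>\<^sub>V\<close> and
  off-diagonal block \<open>B\<close>, so its inverse has blocks \<open>A\<inverse>\<close>, \<open>D\<inverse>\<close> and \<open>- A\<inverse> B D\<inverse>\<close>. By the
  conditions on the partition and on the cut, \<open>B\<close> is constant on each product of a lower with an upper
  chain, where it takes the corresponding entry of \<open>J\<close>; summing the inverse over blocks gives the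
  second identity, and multiplying it by \<open>J\<close> gives the first.\<close>

section \<open>Inverse relations between the Moebius and zeta functions\<close>

lemma is_moebius_moebius:
  assumes "finite P" "partial_order_on P r"
  shows "is_moebius P r (moebius P r)"
  unfolding moebius_def using ex1_moebius[OF assms] by (rule theI')

lemma moebius_outside:
  assumes "finite P" "partial_order_on P r" "(x, y) \<notin> r"
  shows "moebius P r x y = 0"
  using is_moebius_moebius[OF assms(1,2)] assms(3)
  by (auto simp: is_moebius_def incidence_algebra_def)

text \<open>Outside the interval from \<open>x\<close> to \<open>y\<close> one of the two factors
  vanishes. With the fixed index set \<open>P\<close>, convolution becomes a matrix product whose
  sum can be split along subsets of \<open>P\<close>.\<close>

lemma convolution_eq_sum_carrier:
  assumes "finite P" "r \<subseteq> P \<times> P" "f \<in> incidence_algebra r" "g \<in> incidence_algebra r"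
  shows "convolution r f g x y = (\<Sum>z\<in>P. f x z * g z y)"
  unfolding convolution_def
proof (rule sum.mono_neutral_left)
  show "\<forall>z\<in>P - {z. (x, z) \<in> r \<and> (z, y) \<in> r}. f x z * g z y = 0"
    using assms(3,4) by (force simp: incidence_algebra_def)
qed (use assms(1,2) in auto)

lemma zeta_in_incidence_algebra: "zeta r \<in> incidence_algebra r"
  by (simp add: zeta_def incidence_algebra_def)

lemma sum_moebius_zeta:
  fixes P :: "'b set"
  assumes "finite P" "partial_order_on P r"
  shows "(\<Sum>z\<in>P. moebius P r x z * zeta r z y) = (incidence_unit P x y :: 'a::comm_ring_1)"
    and "(\<Sum>z\<in>P. zeta r x z * moebius P r z y) = (incidence_unit P x y :: 'a)"
proof -
  have mu: "is_moebius P r (moebius P r :: 'b \<Rightarrow> 'b \<Rightarrow> 'a)"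
    by (rule is_moebius_moebius[OF assms])
  note carrier = convolution_eq_sum_carrier[OF assms(1) partial_order_onD(4)[OF assms(2)], symmetric]
  show "(\<Sum>z\<in>P. moebius P r x z * zeta r z y) = (incidence_unit P x y :: 'a)"
    using mu by (subst carrier) (simp_all add: is_moebius_def zeta_in_incidence_algebra)
  show "(\<Sum>z\<in>P. zeta r x z * moebius P r z y) = (incidence_unit P x y :: 'a)"
    using mu by (subst carrier) (simp_all add: is_moebius_def zeta_in_incidence_algebra)
qed

section \<open>Moebius functions on convex subsets and across a down-set\<close>

lemma partial_order_on_Restr:
  assumes "partial_order_on P r" "Q \<subseteq> P"
  shows "partial_order_on Q (Restr r Q)"
  using assms
  by (auto simp: partial_order_on_def preorder_on_def refl_on_def trans_Restr antisym_def)

text \<open>A left inverse of zeta is already the two-sided one: by associativity, f * zeta * mu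
  equals both mu and f.\<close>

lemma moebius_eqI:
  fixes f :: "'b \<Rightarrow> 'b \<Rightarrow> 'a::comm_ring_1"
  assumes "finite P" "partial_order_on P r" "f \<in> incidence_algebra r"
    and "convolution r f (zeta r) = incidence_unit P"
  shows "moebius P r = f"
proof -
  have fin: "finite r"
    using finite_subset[OF partial_order_onD(4)[OF assms(2)]] assms(1) by simp
  have mu: "is_moebius P r (moebius P r :: 'b \<Rightarrow> 'b \<Rightarrow> 'a)"
    by (rule is_moebius_moebius[OF assms(1,2)])
  have "moebius P r = convolution r (convolution r f (zeta r)) (moebius P r :: 'b \<Rightarrow> 'b \<Rightarrow> 'a)"
    using mu assms(4) by (simp add: is_moebius_def convolution_unit_left[OF fin assms(2)])
  also have "\<dots> = convolution r f (convolution r (zeta r) (moebius P r))"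
    by (rule convolution_assoc[OF fin partial_order_onD(2)[OF assms(2)]])
  also have "\<dots> = f"
    using mu assms(3) by (simp add: is_moebius_def convolution_unit_right[OF fin assms(2)])
  finally show ?thesis .
qed

text \<open>A Moebius value depends only on the interval between its arguments, and convexity keeps
  that interval inside \<open>Q\<close>.\<close>

lemma moebius_Restr_convex:
  assumes P: "finite P" "partial_order_on P r" and "Q \<subseteq> P"
    and convex: "\<And>x y z. x \<in> Q \<Longrightarrow> y \<in> Q \<Longrightarrow> (x, z) \<in> r \<Longrightarrow> (z, y) \<in> r \<Longrightarrow> z \<in> Q"
    and "x \<in> Q" "y \<in> Q"
  shows "moebius Q (Restr r Q) x y = (moebius P r x y :: 'a::comm_ring_1)"
proof -
  \<comment> \<open>\<open>moebius_eqI\<close> compares whole functions, while the claim concerns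
    arguments in \<open>Q\<close> only; the default 0 elsewhere places \<open>?f\<close> in the
    incidence algebra of \<open>Restr r Q\<close>.\<close>
  let ?f = "\<lambda>x y. if x \<in> Q \<and> y \<in> Q then moebius P r x y else (0 :: 'a)"
  have Q: "finite Q" "partial_order_on Q (Restr r Q)"
    using assms(1,3) finite_subset partial_order_on_Restr[OF P(2) assms(3)] by auto
  have f: "?f \<in> incidence_algebra (Restr r Q)"
    by (auto simp: incidence_algebra_def moebius_outside[OF P])
  have "convolution (Restr r Q) ?f (zeta (Restr r Q)) x y = incidence_unit Q x y" for x y
  proof (cases "x \<in> Q \<and> y \<in> Q")
    case True
    have "convolution (Restr r Q) ?f (zeta (Restr r Q)) x y
        = (\<Sum>z\<in>Q. moebius P r x z * zeta r z y)"
      using True by (subst convolution_eq_sum_carrier[OF Q(1) _ f zeta_in_incidence_algebra])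
        (auto simp: zeta_def intro!: sum.cong)
    also have "\<dots> = (\<Sum>z\<in>P. moebius P r x z * zeta r z y)"
    proof (rule sum.mono_neutral_left)
      show "\<forall>z\<in>P - Q. moebius P r x z * zeta r z y = 0"
      proof
        fix z assume "z \<in> P - Q"
        then have "(x, z) \<notin> r \<or> (z, y) \<notin> r"
          using True convex by blast
        then show "moebius P r x z * zeta r z y = 0"
          by (auto simp: zeta_def moebius_outside[OF P])
      qed
    qed (use P assms(3) in auto)
    also have "\<dots> = incidence_unit Q x y"
      using True assms(3) by (subst sum_moebius_zeta[OF P]) (auto simp: incidence_unit_def)
    finally show ?thesis .
  next
    case False
    then have "{z. (x, z) \<in> Restr r Q \<and> (z, y) \<in> Restr r Q} = {}"
      by auto
    then have "convolution (Restr r Q) ?f (zeta (Restr r Q)) x y = 0"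
      unfolding convolution_def by (simp only: sum.empty)
    with False show ?thesis
      by (auto simp: incidence_unit_def)
  qed
  then have "moebius Q (Restr r Q) = ?f"
    by (intro moebius_eqI Q f ext)
  with assms(5,6) show ?thesis
    by simp
qed

text \<open>This is the off-diagonal block of the inverse of a block triangular matrix. The relation
  zeta * mu = 1 trades the sum over \<open>U\<close> for minus a sum over \<open>L\<close>; there mu
  * zeta is the identity, which leaves a single term.\<close>

lemma moebius_across_down_set:
  assumes P: "finite P" "partial_order_on P r" and "P = L \<union> U" "L \<inter> U = {}"
    and down: "\<And>x y. (x, y) \<in> r \<Longrightarrow> y \<in> L \<Longrightarrow> x \<in> L"
    and x: "x \<in> L" and y: "y \<in> U"
  shows "moebius P r x y
    = - (\<Sum>z\<in>L. \<Sum>w\<in>U. moebius P r x z * zeta r z w * moebius P r w y :: 'a::comm_ring_1)"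
proof -
  let ?\<mu> = "moebius P r :: _ \<Rightarrow> _ \<Rightarrow> 'a" and ?\<zeta> = "zeta r :: _ \<Rightarrow> _ \<Rightarrow> 'a"
  have fin: "finite L" "finite U"
    using P(1) assms(3) by auto
  \<comment> \<open>Since \<open>L\<close> and \<open>U\<close> are disjoint, \<open>z\<close>
    differs from \<open>y\<close>, so the sum over all of \<open>P\<close> is 0.\<close>
  have upper: "(\<Sum>w\<in>U. ?\<zeta> z w * ?\<mu> w y) = - (\<Sum>w\<in>L. ?\<zeta> z w * ?\<mu> w y)" if "z \<in> L" for z
  proof -
    have "(\<Sum>w\<in>L. ?\<zeta> z w * ?\<mu> w y) + (\<Sum>w\<in>U. ?\<zeta> z w * ?\<mu> w y) = (\<Sum>w\<in>P. ?\<zeta> z w * ?\<mu> w y)"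
      unfolding assms(3) using fin assms(4) by (simp add: sum.union_disjoint)
    also have "\<dots> = 0"
      using that y assms(4) by (subst sum_moebius_zeta[OF P]) (auto simp: incidence_unit_def)
    finally show ?thesis
      by (simp add: eq_neg_iff_add_eq_0 add.commute)
  qed
  \<comment> \<open>By \<open>down\<close>, no element of \<open>U\<close> lies below
    \<open>w\<close>, so the sum over \<open>L\<close> is already the sum over
    \<open>P\<close>.\<close>
  have lower: "(\<Sum>z\<in>L. ?\<mu> x z * ?\<zeta> z w) = (if w = x then 1 else 0)" if "w \<in> L" for w
  proof -
    have "(\<Sum>z\<in>L. ?\<mu> x z * ?\<zeta> z w) = (\<Sum>z\<in>P. ?\<mu> x z * ?\<zeta> z w)"
      by (rule sum.mono_neutral_left) (use P(1) assms(3) down that in \<open>auto simp: zeta_def\<close>)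
    also have "\<dots> = (if w = x then 1 else 0)"
      using x assms(3) by (subst sum_moebius_zeta[OF P]) (auto simp: incidence_unit_def)
    finally show ?thesis .
  qed
  have "(\<Sum>z\<in>L. \<Sum>w\<in>U. ?\<mu> x z * ?\<zeta> z w * ?\<mu> w y)
      = (\<Sum>z\<in>L. ?\<mu> x z * (\<Sum>w\<in>U. ?\<zeta> z w * ?\<mu> w y))"
    by (simp add: sum_distrib_left mult.assoc)
  also have "\<dots> = - (\<Sum>z\<in>L. \<Sum>w\<in>L. ?\<mu> x z * ?\<zeta> z w * ?\<mu> w y)"
    by (simp add: upper sum_distrib_left sum_negf mult.assoc)
  also have "\<dots> = - (\<Sum>w\<in>L. (\<Sum>z\<in>L. ?\<mu> x z * ?\<zeta> z w) * ?\<mu> w y)"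
    by (subst sum.swap) (simp add: sum_distrib_right)
  also have "(\<Sum>w\<in>L. (\<Sum>z\<in>L. ?\<mu> x z * ?\<zeta> z w) * ?\<mu> w y) = (\<Sum>w\<in>L. if w = x then ?\<mu> x y else 0)"
    by (rule sum.cong) (auto simp: lower)
  also have "\<dots> = ?\<mu> x y"
    using x fin by simp
  finally show ?thesis
    by simp
qed

section \<open>Blocks of a concatenated list and block-compression\<close>

lemma concat_nth_block:
  assumes "k < length xss" "j < length (xss ! k)"
  shows "concat xss ! (sum_list (take k (map length xss)) + j) = xss ! k ! j"
  using assms
proof (induction xss arbitrary: k)
  case (Cons xs xss)
  then show ?case
    by (cases k) (auto simp: nth_append add.assoc)
qed simp

lemma block_image:
  assumes "k < length xss"
  shows "block (map length xss) k
    = (\<lambda>j. sum_list (take k (map length xss)) + j) ` {..<length (xss ! k)}"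
  using assms by (simp add: block_def take_Suc_conv_app_nth lessThan_atLeast0 add.commute)

text \<open>Distinctness matches the positions of the block one-to-one with the elements of the
  list, so index arithmetic gives way to sums over sets.\<close>

lemma sum_block:
  assumes "k < length xss" "distinct (xss ! k)"
  shows "(\<Sum>p\<in>block (map length xss) k. f (concat xss ! p)) = sum f (set (xss ! k))"
proof -
  have "(\<Sum>p\<in>block (map length xss) k. f (concat xss ! p)) = (\<Sum>j<length (xss ! k). f (xss ! k ! j))"
    by (simp add: block_image assms(1) sum.reindex inj_on_def concat_nth_block)
  also have "\<dots> = sum f (set (xss ! k))"
    using sum.reindex_bij_betw[OF bij_betw_nth[OF assms(2) refl refl], of f] by simp
  finally show ?thesis .
qed

text \<open>Keeps the blocks inside the matrix, where the entries of \<open>mat\<close> are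
  specified.\<close>

lemma block_bound:
  assumes "k < length xss" "p \<in> block (map length xss) k"
  shows "p < length (concat xss)"
proof -
  have "sum_list (take (Suc k) (map length xss)) \<le> sum_list (map length xss)"
    by (subst (2) append_take_drop_id[symmetric, of _ "Suc k"])
      (simp only: sum_list_append le_add1)
  with assms(2) show ?thesis
    by (simp add: block_def length_concat)
qed

text \<open>The case distinction in \<open>moebius_mat\<close> drops out because the Moebius
  function is 0 off \<open>r\<close>; the inner and then the outer sum is carried over to
  sets.\<close>

lemma block_compress_moebius_mat:
  assumes P: "finite P" "partial_order_on P r"
    and "\<And>i. i < length xss \<Longrightarrow> distinct (xss ! i)" and "k < length xss" "l < length xss"
  shows "block_compress (moebius_mat P r (concat xss)) (map length xss) $$ (k, l)
    = (\<Sum>x\<in>set (xss ! k). \<Sum>y\<in>set (xss ! l). moebius P r x y)"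
proof -
  have "block_compress (moebius_mat P r (concat xss)) (map length xss) $$ (k, l)
      = (\<Sum>p\<in>block (map length xss) k. \<Sum>q\<in>block (map length xss) l.
          moebius P r (concat xss ! p) (concat xss ! q))"
    using assms(4,5) unfolding block_compress_def
    by (auto simp: moebius_mat_def moebius_outside[OF P] block_bound[of _ xss] intro!: sum.cong)
  also have "\<dots> = (\<Sum>x\<in>set (xss ! k). \<Sum>y\<in>set (xss ! l). moebius P r x y)"
    using assms(3-5)
    by (simp add: sum_block[where f = "moebius P r _"]
        sum_block[where f = "\<lambda>x. \<Sum>y\<in>set (xss ! l). moebius P r x y"])
  finally show ?thesis .
qed

lemma sum_UN_nth_disjoint:
  assumes "\<And>i j. i < length xss \<Longrightarrow> j < length xss \<Longrightarrow> i \<noteq> j \<Longrightarrow> set (xss ! i) \<inter> set (xss ! j) = {}"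
  shows "sum f (\<Union>xs\<in>set xss. set xs) = (\<Sum>i<length xss. sum f (set (xss ! i)))"
proof -
  have "(\<Union>xs\<in>set xss. set xs) = (\<Union>i<length xss. set (xss ! i))"
    by (auto simp: set_conv_nth[of xss])
  then show ?thesis
    using assms by (simp add: sum.UNION_disjoint)
qed

section \<open>Chains and comparability between chains\<close>

lemma ascending_chain_distinct:
  assumes "ascending_chain r xs"
  shows "distinct xs"
proof -
  have "sorted_wrt (\<noteq>) xs"
    by (rule sorted_wrt_mono_rel[OF _ assms[unfolded ascending_chain_def]])
      (auto simp: strictly_below_def)
  then show ?thesis
    by (simp add: distinct_conv_nth sorted_wrt_iff_nth_less) (metis nat_neq_iff)
qed

text \<open>The partition condition makes comparability a relation between chains. The disjunct
  \<open>i = j\<close> matches the summand \<open>1\<^sub>m n\<close> of J, the other one the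
  off-diagonal entries; on the diagonal, reflexivity supplies the comparable pair.\<close>

lemma chain_partition_comparable_iff:
  assumes "chain_partition P r Cs" "refl_on P r" "i < length Cs" "j < length Cs"
    and "x \<in> set (Cs ! i)" "y \<in> set (Cs ! j)"
  shows "comparable r x y
    \<longleftrightarrow> i = j \<or> (\<exists>x\<in>set (Cs ! i). \<exists>y\<in>set (Cs ! j). comparable r x y)"
proof -
  have "x \<in> P"
    using assms(1,3,5) by (auto simp: chain_partition_def)
  then have "comparable r x x"
    using assms(2) by (auto simp: comparable_def refl_on_def)
  moreover have "comparable r x y"
    if "x' \<in> set (Cs ! i)" "y' \<in> set (Cs ! j)" "comparable r x' y'" for x' y'
    using assms(1,3-6) that unfolding chain_partition_def by blast
  ultimately show ?thesis
    using assms(5,6) by blast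
qed

section \<open>Block decomposition along the cut\<close>

theorem theorem4:
  fixes P :: "'b set" and r :: "'b rel"
    and Cs :: "'b list list" and h :: "nat \<Rightarrow> nat" and n :: nat
    and Plow Pup :: "'b set"
    and U Ulow Uup J :: "'a::comm_ring_1 mat"
    and s s_low s_up :: "nat list"
  assumes "finite P" and "partial_order_on P r"
    and "chain_partition P r Cs" and "n = length Cs"
    and "chain_cut r Cs h"
    and "\<And>i. i < n \<Longrightarrow> 1 \<le> h i \<and> 1 \<le> length (Cs ! i) - h i"
    and "Plow = (\<Union>C\<in>set (low_chains Cs h). set C)"
    and "Pup = (\<Union>C\<in>set (up_chains Cs h). set C)"
    and "U = moebius_mat P r (concat Cs)"
    and "Ulow = moebius_mat Plow (Restr r Plow) (concat (low_chains Cs h))"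
    and "Uup = moebius_mat Pup (Restr r Pup) (concat (up_chains Cs h))"
    and "s = map (\<lambda>i. length (Cs ! i)) [0..<n]"
    and "s_low = map (\<lambda>i. h i) [0..<n]"
    and "s_up = map (\<lambda>i. length (Cs ! i) - h i) [0..<n]"
    and "J = 1\<^sub>m n + comparability_mat r Cs"
  shows "block_compress U s * J
       = block_compress Ulow s_low * J + block_compress Uup s_up * J
         - block_compress Ulow s_low * J * block_compress Uup s_up * J
     \<and> (invertible_mat J \<longrightarrow>
        block_compress U s
       = block_compress Ulow s_low + block_compress Uup s_up
         - block_compress Ulow s_low * J * block_compress Uup s_up)"
proof -
  define Ls where "Ls = low_chains Cs h"
  define Us where "Us = up_chains Cs h"
  let ?\<mu> = "moebius P r :: 'b \<Rightarrow> 'b \<Rightarrow> 'a"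
  let ?S = "\<lambda>A B. \<Sum>x\<in>A. \<Sum>y\<in>B. ?\<mu> x y"
  note P = assms(1,2)
  have len: "length Ls = n" "length Us = n"
    by (simp_all add: Ls_def Us_def low_chains_def up_chains_def assms(4))
  have nth: "Ls ! i = take (h i) (Cs ! i)" "Us ! i = drop (h i) (Cs ! i)" if "i < n" for i
    using that by (simp_all add: Ls_def Us_def low_chains_def up_chains_def assms(4))
  \<comment> \<open>The bound \<open>h i\<close> \<le> \<open>length (Cs ! i)\<close> in
    \<open>chain_cut\<close> gives \<open>take (h i)\<close> exactly the length
    \<open>h i\<close>.\<close>
  have s: "s = map length Cs" "s_low = map length Ls" "s_up = map length Us"
    using assms(5) len
    by (auto simp: chain_cut_def assms(4,12-14) nth intro!: nth_equalityI)
  have dist: "distinct (Cs ! i)" if "i < n" for i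
    using assms(3,4) that by (auto simp: chain_partition_def intro: ascending_chain_distinct)
  have disj: "set (Cs ! i) \<inter> set (Cs ! j) = {}" if "i < n" "j < n" "i \<noteq> j" for i j
    using assms(3,4) that by (auto simp: chain_partition_def)
  have parts: "set (Cs ! i) = set (Ls ! i) \<union> set (Us ! i)" "set (Ls ! i) \<inter> set (Us ! i) = {}"
    "distinct (Ls ! i)" "distinct (Us ! i)" if "i < n" for i
    using dist[OF that] that
    by (simp_all add: nth set_take_disj_set_drop_if_distinct flip: set_append)
  have UN: "(\<Union>C\<in>set Xs. set C) = (\<Union>i<length Xs. set (Xs ! i))" for Xs :: "'b list list"
    by (auto simp: set_conv_nth[of Xs])
  have Plow: "Plow = (\<Union>i<n. set (Ls ! i))" and Pup: "Pup = (\<Union>i<n. set (Us ! i))"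
    by (simp_all add: assms(7,8) UN len flip: Ls_def Us_def)
  have PC: "P = (\<Union>i<n. set (Cs ! i))"
    using assms(3,4) UN[of Cs] by (simp add: chain_partition_def)
  have P_eq: "P = Plow \<union> Pup"
    unfolding PC Plow Pup using parts(1) by blast
  have PP: "Plow \<inter> Pup = {}"
    unfolding Plow Pup using parts(1,2) disj by (fastforce simp: disjoint_iff)
  have cut: "strictly_below r x y" if "x \<in> Plow" "y \<in> Pup" "comparable r x y" for x y
    using assms(5) that unfolding Plow Pup by (auto simp: chain_cut_def Ls_def Us_def assms(4))
  have antisym: "antisym r" and reflP: "refl_on P r"
    using P(2) by (simp_all add: partial_order_on_def preorder_on_def)
  have rP: "r \<subseteq> P \<times> P"
    using P(2) by (rule partial_order_onD)
  \<comment> \<open>If \<open>y\<close> were below \<open>x\<close>, the two would be comparable,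
    and the cut would also put \<open>x\<close> strictly below \<open>y\<close>, against
    antisymmetry.\<close>
  have not_above: "(y, x) \<notin> r" if "x \<in> Plow" "y \<in> Pup" for x y
    using cut[OF that] antisymD[OF antisym, of x y]
    by (auto simp: comparable_def strictly_below_def)
  have down: "x \<in> Plow" if "(x, y) \<in> r" "y \<in> Plow" for x y
    using not_above[OF that(2)] that rP P_eq by blast
  have up: "y \<in> Pup" if "(x, y) \<in> r" "x \<in> Pup" for x y
    using not_above that rP P_eq by blast
  have sub: "Plow \<subseteq> P" "Pup \<subseteq> P"
    using P_eq by auto
  \<comment> \<open>Down-sets and up-sets are convex, so both induced Moebius functions agree with
    that of \<open>P\<close>.\<close>
  have \<mu>_low: "moebius Plow (Restr r Plow) x y = ?\<mu> x y" if "x \<in> Plow" "y \<in> Plow" for x y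
    using that by (intro moebius_Restr_convex P sub) (auto intro: down)
  have \<mu>_up: "moebius Pup (Restr r Pup) x y = ?\<mu> x y" if "x \<in> Pup" "y \<in> Pup" for x y
    using that by (intro moebius_Restr_convex P sub) (auto intro: up)
  \<comment> \<open>The off-diagonal zeta block is constant on products of chains: the cut turns
    comparability into \<open>z\<close> \<le> \<open>w\<close>, and the partition makes it
    independent of the chosen elements.\<close>
  have J: "zeta r z w = J $$ (i, j)"
    if "i < n" "j < n" "z \<in> set (Ls ! i)" "w \<in> set (Us ! j)" for i j z w
  proof -
    have zw: "z \<in> Plow" "w \<in> Pup" "z \<in> set (Cs ! i)" "w \<in> set (Cs ! j)"
      using that parts(1) by (auto simp: Plow Pup)
    have "(z, w) \<in> r \<longleftrightarrow> comparable r z w"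
      using cut[OF zw(1,2)] by (auto simp: comparable_def strictly_below_def)
    also have "\<dots> \<longleftrightarrow> i = j \<or> (\<exists>x\<in>set (Cs ! i). \<exists>y\<in>set (Cs ! j). comparable r x y)"
      using chain_partition_comparable_iff[OF assms(3) reflP _ _ zw(3,4)] that(1,2) assms(4) by simp
    finally show ?thesis
      using that(1,2) assms(4) by (auto simp: assms(15) comparability_mat_def zeta_def)
  qed
  let ?c = "block_compress U s" and ?l = "block_compress Ulow s_low" and ?u = "block_compress Uup s_up"
  have carr: "?c \<in> carrier_mat n n" "?l \<in> carrier_mat n n" "?u \<in> carrier_mat n n" "J \<in> carrier_mat n n"
    using assms(4,15) len by (auto simp: block_compress_def s comparability_mat_def)
  \<comment> \<open>All three compressions are now expressed through the one function
    \<open>?\<mu>\<close>.\<close>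
  have c: "?c $$ (k, l) = ?S (set (Cs ! k)) (set (Cs ! l))" if "k < n" "l < n" for k l
    unfolding assms(9) s using that assms(4) dist by (intro block_compress_moebius_mat P) auto
  have low: "?l $$ (k, l) = ?S (set (Ls ! k)) (set (Ls ! l))" if "k < n" "l < n" for k l
  proof -
    have "?l $$ (k, l) = (\<Sum>x\<in>set (Ls ! k). \<Sum>y\<in>set (Ls ! l). moebius Plow (Restr r Plow) x y)"
      unfolding assms(10) s Ls_def[symmetric] using that len parts(3)
      by (intro block_compress_moebius_mat finite_subset[OF sub(1) P(1)]
          partial_order_on_Restr[OF P(2) sub(1)]) auto
    also have "\<dots> = ?S (set (Ls ! k)) (set (Ls ! l))"
      using that by (intro sum.cong refl \<mu>_low) (auto simp: Plow)
    finally show ?thesis .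
  qed
  have upp: "?u $$ (k, l) = ?S (set (Us ! k)) (set (Us ! l))" if "k < n" "l < n" for k l
  proof -
    have "?u $$ (k, l) = (\<Sum>x\<in>set (Us ! k). \<Sum>y\<in>set (Us ! l). moebius Pup (Restr r Pup) x y)"
      unfolding assms(11) s Us_def[symmetric] using that len parts(4)
      by (intro block_compress_moebius_mat finite_subset[OF sub(2) P(1)]
          partial_order_on_Restr[OF P(2) sub(2)]) auto
    also have "\<dots> = ?S (set (Us ! k)) (set (Us ! l))"
      using that by (intro sum.cong refl \<mu>_up) (auto simp: Pup)
    finally show ?thesis .
  qed
  have disj': "set (Ls ! i) \<inter> set (Ls ! j) = {}" "set (Us ! i) \<inter> set (Us ! j) = {}"
    if "i < n" "j < n" "i \<noteq> j" for i j
    using disj[OF that] parts(1) that by blast+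
  have sum_Plow: "sum f Plow = (\<Sum>i<n. sum f (set (Ls ! i)))" for f :: "'b \<Rightarrow> 'a"
    using sum_UN_nth_disjoint[of Ls f] disj'(1) by (simp add: assms(7) len flip: Ls_def)
  have sum_Pup: "sum f Pup = (\<Sum>i<n. sum f (set (Us ! i)))" for f :: "'b \<Rightarrow> 'a"
    using sum_UN_nth_disjoint[of Us f] disj'(2) by (simp add: assms(8) len flip: Us_def)
  \<comment> \<open>The double sum over \<open>Plow\<close> and \<open>Pup\<close> is split by
    chains. Within a pair of chains zeta is the constant \<open>J $$ (i, j)\<close>, so it comes out
    and the rest factors into a lower and an upper sum.\<close>
  have cross: "?S (set (Ls ! k)) (set (Us ! l)) = - (?l * J * ?u) $$ (k, l)" if kl: "k < n" "l < n" for k l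
  proof -
    have \<mu>: "?\<mu> x y = - (\<Sum>j<n. \<Sum>i<n. J $$ (i, j) *
        ((\<Sum>z\<in>set (Ls ! i). ?\<mu> x z) * (\<Sum>w\<in>set (Us ! j). ?\<mu> w y)))"
      if "x \<in> set (Ls ! k)" "y \<in> set (Us ! l)" for x y
    proof -
      have "?\<mu> x y = - (\<Sum>z\<in>Plow. \<Sum>w\<in>Pup. ?\<mu> x z * zeta r z w * ?\<mu> w y)"
        using that kl by (intro moebius_across_down_set[OF P P_eq PP down]) (auto simp: Plow Pup)
      also have "(\<Sum>z\<in>Plow. \<Sum>w\<in>Pup. ?\<mu> x z * zeta r z w * ?\<mu> w y)
          = (\<Sum>i<n. \<Sum>z\<in>set (Ls ! i). \<Sum>j<n. \<Sum>w\<in>set (Us ! j). ?\<mu> x z * zeta r z w * ?\<mu> w y)"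
        by (simp add: sum_Plow sum_Pup)
      also have "\<dots> = (\<Sum>i<n. \<Sum>z\<in>set (Ls ! i). \<Sum>j<n. \<Sum>w\<in>set (Us ! j). J $$ (i, j) * (?\<mu> x z * ?\<mu> w y))"
        by ((rule sum.cong[OF refl])+) (simp add: J mult_ac)
      also have "\<dots> = (\<Sum>i<n. \<Sum>j<n. \<Sum>z\<in>set (Ls ! i). \<Sum>w\<in>set (Us ! j). J $$ (i, j) * (?\<mu> x z * ?\<mu> w y))"
        by (rule sum.cong[OF refl], rule sum.swap)
      \<comment> \<open>The sum over \<open>j\<close> moves outside to match the nesting of
        (\<open>?l * J\<close>) * \<open>?u\<close>.\<close>
      also have "\<dots> = (\<Sum>j<n. \<Sum>i<n. \<Sum>z\<in>set (Ls ! i). \<Sum>w\<in>set (Us ! j). J $$ (i, j) * (?\<mu> x z * ?\<mu> w y))"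
        by (rule sum.swap)
      finally show ?thesis
        by (simp only: sum_product) (simp only: sum_distrib_left)
    qed
    have "?S (set (Ls ! k)) (set (Us ! l))
        = - (\<Sum>x\<in>set (Ls ! k). \<Sum>y\<in>set (Us ! l). \<Sum>j<n. \<Sum>i<n. J $$ (i, j) *
            ((\<Sum>z\<in>set (Ls ! i). ?\<mu> x z) * (\<Sum>w\<in>set (Us ! j). ?\<mu> w y)))"
      by (simp add: \<mu> sum_negf)
    also have "(\<Sum>x\<in>set (Ls ! k). \<Sum>y\<in>set (Us ! l). \<Sum>j<n. \<Sum>i<n. J $$ (i, j) *
            ((\<Sum>z\<in>set (Ls ! i). ?\<mu> x z) * (\<Sum>w\<in>set (Us ! j). ?\<mu> w y)))
        = (\<Sum>j<n. \<Sum>i<n. \<Sum>x\<in>set (Ls ! k). \<Sum>y\<in>set (Us ! l). J $$ (i, j) *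
            ((\<Sum>z\<in>set (Ls ! i). ?\<mu> x z) * (\<Sum>w\<in>set (Us ! j). ?\<mu> w y)))"
      by (simp only: sum.swap[of _ "{..<n}" "set (Us ! l)"] sum.swap[of _ "{..<n}" "set (Ls ! k)"])
    also have "\<dots> = (\<Sum>j<n. \<Sum>i<n. J $$ (i, j) * (?S (set (Ls ! k)) (set (Ls ! i)) *
            (\<Sum>y\<in>set (Us ! l). \<Sum>w\<in>set (Us ! j). ?\<mu> w y)))"
      by (simp only: sum_product) (simp only: sum_distrib_left)
    \<comment> \<open>An entry of \<open>?u\<close> sums over its row elements \<open>w\<close>
      outermost, hence the swap with \<open>y\<close>.\<close>
    also have "\<dots> = (\<Sum>j<n. \<Sum>i<n. ?l $$ (k, i) * J $$ (i, j) * ?u $$ (j, l))"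
      by ((rule sum.cong[OF refl])+, subst sum.swap[of "\<lambda>y w. ?\<mu> w y"])
        (simp add: kl low upp mult_ac)
    \<comment> \<open>Without \<open>assoc_mult_mat\<close> the product stays bracketed to the
      left.\<close>
    also have "\<dots> = (?l * J * ?u) $$ (k, l)"
      using carr kl
      by (simp add: scalar_prod_def sum_distrib_right lessThan_atLeast0 del: assoc_mult_mat)
    finally show ?thesis .
  qed
  have main: "?c = ?l + ?u - ?l * J * ?u"
  proof (rule eq_matI)
    fix k l assume "k < dim_row (?l + ?u - ?l * J * ?u)" "l < dim_col (?l + ?u - ?l * J * ?u)"
    with carr have kl: "k < n" "l < n"
      by auto
    have split: "sum f (set (Cs ! i)) = sum f (set (Ls ! i)) + sum f (set (Us ! i))"
      if "i < n" for i and f :: "'b \<Rightarrow> 'a"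
      using parts(1,2)[OF that] by (simp add: sum.union_disjoint)
    \<comment> \<open>Splitting both chains gives four sums; this one vanishes because no upper
      element lies below a lower one.\<close>
    have "?S (set (Us ! k)) (set (Ls ! l)) = 0"
      using kl by (intro sum.neutral ballI moebius_outside P not_above) (auto simp: Plow Pup)
    then have "?c $$ (k, l) = ?l $$ (k, l) + ?u $$ (k, l) + ?S (set (Ls ! k)) (set (Us ! l))"
      using kl by (simp add: c low upp split sum.distrib)
    also have "\<dots> = ?l $$ (k, l) + ?u $$ (k, l) - (?l * J * ?u) $$ (k, l)"
      using cross[OF kl] by simp
    also have "\<dots> = (?l + ?u - ?l * J * ?u) $$ (k, l)"
      using carr kl by simp
    finally show "?c $$ (k, l) = (?l + ?u - ?l * J * ?u) $$ (k, l)" .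
  qed (use carr in auto)
  \<comment> \<open>Right multiplication of \<open>main\<close> by \<open>J\<close>;
    \<open>carr\<close> supplies the dimensions for distributivity.\<close>
  have "?c * J = ?l * J + ?u * J - ?l * J * ?u * J"
    unfolding main using carr
    by (simp add: minus_mult_distrib_mat[of _ n n] add_mult_distrib_mat[of _ n n])
  with main show ?thesis
    by blast
qed

end
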